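(* Let $(D,\vec{s})$ be a data distribution derived from a $2\text{-}(v,k,1)$ design with $k\ge 2$, and suppose the data set is partitioned into $v$ data groups (one for each symbol of the design) each containing the same number of data items. Then the ATAC computation can be effectively load balanced: there is an assignment of every unordered pair of distinct data items to a machine holding both items such that the numbers of pairs assigned to any two machines differ by at most $1$.
   Context: A $2\text{-}(v,k,1)$ design (balanced incomplete block design with $\lambda=1$) is a set of $v$ symbols together with $m$ blocks such that each block contains exactly $k$ symbols, each symbol appears in exactly $r$ blocks, and each pair of distinct symbols appears together in exactly $1$ block. The data distribution derived from it is $(D,\vec{s})$, where $D$ is the $m\times v$ zero-one incidence matrix (rows indexed by blocks, columns by symbols, entry $1$ iff the block contains the symbol) and $\vec{s}=(\tfrac1v,\dots,\tfrac1v)^T\in\mathbb{R}^v$. Blocks are interpreted as machines and symbols as data groups: the data items are partitioned into $v$ data groups, data group $j$ containing the fraction $s_j=\tfrac1v$ of all items, and machine $i$ holds all items of every data group $j$ with $D_{ij}=1$ (and no others). An ATAC (All-to-All Comparison) computation requires that every unordered pair of distinct data items (in the same or in different data groups) be compared exactly once, on a machine that holds both items. All machines are equally capable and every comparison takes the same time, so the load of a machine is the number of comparisons assigned to it. A schedule is effectively load balanced if no machine is assigned more than $1$ comparison more than any other machine. *)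

theory Defs
  imports Complex_Main "HOL-Library.Disjoint_Sets"
begin

(* A 2-(v,k,1) design on the symbol set V.  The blocks are a family B indexed by the finite set M
   (which also serves as the set of machines), so equal blocks are not identified a priori.
   At least one block is required.  For k >= 2 this is equivalent to the usual convention k <= v;
   it only excludes the block-free structures on at most one symbol. *)
definition design_2_v_k_1 :: "'s set \<Rightarrow> 'm set \<Rightarrow> ('m \<Rightarrow> 's set) \<Rightarrow> nat \<Rightarrow> nat \<Rightarrow> bool" where
  "design_2_v_k_1 V M B v k \<longleftrightarrow>
     finite V \<and> card V = v \<and> finite M \<and> M \<noteq> {} \<and>
     (\<forall>i\<in>M. B i \<subseteq> V \<and> card (B i) = k) \<and>
     (\<exists>r. \<forall>j\<in>V. card {i\<in>M. j \<in> B i} = r) \<and>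
     (\<forall>j\<in>V. \<forall>j'\<in>V. j \<noteq> j' \<longrightarrow> card {i\<in>M. j \<in> B i \<and> j' \<in> B i} = 1)"

(* Matrices and vectors are functions on the index sets: rows M, columns V. *)
definition incidence_matrix :: "('m \<Rightarrow> 's set) \<Rightarrow> 'm \<Rightarrow> 's \<Rightarrow> nat" where
  "incidence_matrix B i j = (if j \<in> B i then 1 else 0)"

definition derived_distribution ::
  "'s set \<Rightarrow> ('m \<Rightarrow> 's set) \<Rightarrow> ('m \<Rightarrow> 's \<Rightarrow> nat) \<times> ('s \<Rightarrow> real)" where
  "derived_distribution V B = (incidence_matrix B, \<lambda>j. 1 / real (card V))"

(* The finite data set X is split into groups G j (j in V), group j having the fraction s j of X. *)
definition data_partition :: "'x set \<Rightarrow> 's set \<Rightarrow> ('s \<Rightarrow> real) \<Rightarrow> ('s \<Rightarrow> 'x set) \<Rightarrow> bool" where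
  "data_partition X V s G \<longleftrightarrow>
     finite X \<and> disjoint_family_on G V \<and> (\<Union>j\<in>V. G j) = X \<and>
     (\<forall>j\<in>V. real (card (G j)) = s j * real (card X))"

definition holds_item ::
  "'s set \<Rightarrow> ('m \<Rightarrow> 's \<Rightarrow> nat) \<Rightarrow> ('s \<Rightarrow> 'x set) \<Rightarrow> 'm \<Rightarrow> 'x \<Rightarrow> bool" where
  "holds_item V D G i x \<longleftrightarrow> (\<exists>j\<in>V. D i j = 1 \<and> x \<in> G j)"

definition item_pairs :: "'x set \<Rightarrow> 'x set set" where
  "item_pairs X = {p. p \<subseteq> X \<and> card p = 2}"

(* That every pair is compared exactly once is expressed by the assignment f being a function. *)
definition ATAC_schedule ::
  "'x set \<Rightarrow> 's set \<Rightarrow> 'm set \<Rightarrow> ('m \<Rightarrow> 's \<Rightarrow> nat) \<Rightarrow> ('s \<Rightarrow> 'x set) \<Rightarrow> ('x set \<Rightarrow> 'm) \<Rightarrow> bool" where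
  "ATAC_schedule X V M D G f \<longleftrightarrow>
     (\<forall>p\<in>item_pairs X. f p \<in> M \<and> (\<forall>x\<in>p. holds_item V D G (f p) x))"

definition load :: "'x set \<Rightarrow> ('x set \<Rightarrow> 'm) \<Rightarrow> 'm \<Rightarrow> nat" where
  "load X f i = card {p \<in> item_pairs X. f p = i}"

definition effectively_load_balanced :: "'x set \<Rightarrow> 'm set \<Rightarrow> ('x set \<Rightarrow> 'm) \<Rightarrow> bool" where
  "effectively_load_balanced X M f \<longleftrightarrow> (\<forall>i\<in>M. \<forall>i'\<in>M. load X f i \<le> load X f i' + 1)"

end

theory Submission
  imports Defs "HOL-Library.Transitive_Closure_Table"
begin

text \<open>Assign each pair to an admissible machine so that the sum of the squared loads is minimal.
  Shifting one pair at every step of a path of possible moves shows that every machine reachable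
  from a machine of maximal load \<open>L\<close> has load at least \<open>L - 1\<close>, and dually that every machine from which
  a machine of minimal load \<open>l\<close> can be reached has load at most \<open>l + 1\<close>. The pairs assigned
  to the machines of the first set are admissible only inside it, and those of the second set
  comprise all pairs admissible on it. A Hall-type condition compares both averages with the overall
  average and forces \<open>L \<le> l + 1\<close>. For a design the Hall condition is a double count: pairs across groups
  contribute the same number to each block, and a set \<open>S\<close> of symbols all of whose blocks lie in \<open>R\<close>
  satisfies \<open>|S| / v \<le> |R| / m\<close>.\<close>

section \<open>Balanced assignments\<close>

definition num_assigned :: "'t set \<Rightarrow> ('t \<Rightarrow> 'm) \<Rightarrow> 'm \<Rightarrow> nat" where
  "num_assigned T f i = card {t \<in> T. f t = i}"

text \<open>The directed graph of single moves; its paths play the role of alternating paths in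
  bipartite matching.\<close>

definition movable :: "'t set \<Rightarrow> ('t \<Rightarrow> 'm set) \<Rightarrow> ('t \<Rightarrow> 'm) \<Rightarrow> 'm \<Rightarrow> 'm \<Rightarrow> bool" where
  "movable T A f i i' \<longleftrightarrow> (\<exists>t\<in>T. f t = i \<and> i' \<in> A t)"

text \<open>The \<open>of_bool\<close> terms stand on both sides to avoid truncated subtraction and
  to cover the case \<open>y = f t\<close>, where they cancel.\<close>

lemma num_assigned_upd:
  assumes "finite T" "t \<in> T"
  shows "num_assigned T (f(t := y)) i + of_bool (i = f t) = num_assigned T f i + of_bool (i = y)"
proof -
  have split: "num_assigned T g i = card {u \<in> T - {t}. g u = i} + of_bool (i = g t)" for g
  proof (cases "g t = i")
    case True
    then have "{u \<in> T. g u = i} = insert t {u \<in> T - {t}. g u = i}"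
      using assms by auto
    then show ?thesis
      using True assms by (simp add: num_assigned_def)
  next
    case False
    then have "{u \<in> T. g u = i} = {u \<in> T - {t}. g u = i}"
      by auto
    then show ?thesis
      using False by (simp add: num_assigned_def)
  qed
  have "{u \<in> T - {t}. (f(t := y)) u = i} = {u \<in> T - {t}. f u = i}"
    by auto
  then show ?thesis
    using split[of f] split[of "f(t := y)"] by simp
qed

text \<open>Moving a task away from the first machine of the path leaves the later steps possible, because
  the path does not return there.\<close>

lemma shift_along_path:
  assumes "rtrancl_path (movable T A f0) a xs c" "distinct (a # xs)" "finite T"
    and "\<And>u w. u \<in> set (a # xs) \<Longrightarrow> movable T A f0 u w \<Longrightarrow> movable T A f u w"
    and "\<forall>t\<in>T. f t \<in> A t"
  shows "\<exists>f'. (\<forall>t\<in>T. f' t \<in> A t) \<and>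
    (\<forall>i. num_assigned T f' i + of_bool (i = a) = num_assigned T f i + of_bool (i = c))"
  using assms
proof (induction arbitrary: f rule: rtrancl_path.induct)
  case (base x)
  then show ?case by blast
next
  case (step a y ys c)
  have "movable T A f a y"
    using step.hyps(1) step.prems(3) by simp
  then obtain t where t: "t \<in> T" "f t = a" "y \<in> A t"
    by (auto simp: movable_def)
  let ?g = "f(t := y)"
  have mov: "movable T A ?g u w" if "u \<in> set (y # ys)" "movable T A f0 u w" for u w
  proof -
    have "movable T A f u w" "u \<noteq> a"
      using that step.prems(1,3) by auto
    then show ?thesis
      using t(2) unfolding movable_def by (metis fun_upd_other)
  qed
  have "\<forall>t\<in>T. ?g t \<in> A t"
    using t step.prems(4) by simp
  with step.IH[of ?g] mov step.prems obtain f' where f':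
    "\<forall>t\<in>T. f' t \<in> A t"
    "\<And>i. num_assigned T f' i + of_bool (i = y) = num_assigned T ?g i + of_bool (i = c)"
    by (metis distinct.simps(2))
  \<comment> \<open>The machine \<open>y\<close> gains a task by the first move and loses one along
    the rest of the path, so only the two ends of the path change.\<close>
  have "num_assigned T f' i + of_bool (i = a) = num_assigned T f i + of_bool (i = c)" for i
    using f'(2)[of i] num_assigned_upd[OF step.prems(2) t(1), of f y i, unfolded t(2)] by linarith
  with f'(1) show ?case by blast
qed

lemma sum_num_assigned:
  assumes "finite T" "finite R"
  shows "(\<Sum>i\<in>R. num_assigned T f i) = card {t \<in> T. f t \<in> R}"
proof -
  have "{t \<in> T. f t \<in> R} = (\<Union>i\<in>R. {t \<in> T. f t = i})"
    by auto
  then show ?thesis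
    using assms by (simp add: num_assigned_def, subst card_UN_disjoint) auto
qed

text \<open>Taking one unit from \<open>a\<close> and giving it to \<open>c\<close> lowers the sum
  of squares by 2 * (\<open>q a\<close> - \<open>q c\<close> - 1), which is at least 2 when the gap
  is at least 2.\<close>

lemma sum_squares_shift_less:
  fixes p q :: "'m \<Rightarrow> nat"
  assumes "finite M" "a \<in> M" "c \<in> M" "q c + 2 \<le> q a"
    and "\<And>i. p i + of_bool (i = a) = q i + of_bool (i = c)"
  shows "(\<Sum>i\<in>M. (p i)\<^sup>2) < (\<Sum>i\<in>M. (q i)\<^sup>2)"
proof -
  have "a \<noteq> c"
    using assms(4) by auto
  have split: "(\<Sum>i\<in>M. (g i)\<^sup>2) = (g a)\<^sup>2 + (g c)\<^sup>2 + (\<Sum>i\<in>M - {a} - {c}. (g i)\<^sup>2)" for g :: "'m \<Rightarrow> nat"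
    using assms(1-3) \<open>a \<noteq> c\<close> by (simp add: sum.remove[of M a] sum.remove[of "M - {a}" c])
  have rest: "(\<Sum>i\<in>M - {a} - {c}. (p i)\<^sup>2) = (\<Sum>i\<in>M - {a} - {c}. (q i)\<^sup>2)"
  proof (rule sum.cong)
    fix i assume "i \<in> M - {a} - {c}"
    then show "(p i)\<^sup>2 = (q i)\<^sup>2"
      using assms(5)[of i] by simp
  qed simp
  obtain d where d: "q a = q c + 2 + d"
    using assms(4) le_Suc_ex by blast
  have "p a = q c + 1 + d" "p c = q c + 1"
    using assms(5)[of a] assms(5)[of c] \<open>a \<noteq> c\<close> d by auto
  then have "(p a)\<^sup>2 + (p c)\<^sup>2 < (q a)\<^sup>2 + (q c)\<^sup>2"
    unfolding d by (simp add: power2_eq_square algebra_simps)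
  then show ?thesis
    unfolding split rest by simp
qed

text \<open>By \<open>hall\<close>, no set of machines is forced to carry an average load above the
  overall average. This is used for the set reachable from an overloaded machine and for the
  complement of the set that can reach an underloaded one.\<close>

lemma balanced_assignment:
  fixes A :: "'t \<Rightarrow> 'm set"
  assumes T: "finite T" and M: "finite M"
    and A: "\<And>t. t \<in> T \<Longrightarrow> A t \<subseteq> M \<and> A t \<noteq> {}"
    and hall: "\<And>R. R \<subseteq> M \<Longrightarrow> card {t \<in> T. A t \<subseteq> R} * card M \<le> card T * card R"
  shows "\<exists>f. (\<forall>t\<in>T. f t \<in> A t) \<and> (\<forall>i\<in>M. \<forall>i'\<in>M. num_assigned T f i \<le> num_assigned T f i' + 1)"
proof -
  define ok where "ok f \<longleftrightarrow> (\<forall>t\<in>T. f t \<in> A t)" for f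
  have "ok (\<lambda>t. SOME i. i \<in> A t)"
    using A by (simp add: ok_def some_in_eq)
  then obtain f where f: "ok f"
    and least: "\<And>g. ok g \<Longrightarrow> (\<Sum>i\<in>M. (num_assigned T f i)\<^sup>2) \<le> (\<Sum>i\<in>M. (num_assigned T g i)\<^sup>2)"
    using ex_has_least_nat[of ok _ "\<lambda>g. \<Sum>i\<in>M. (num_assigned T g i)\<^sup>2"] by blast
  let ?n = "num_assigned T f" and ?E = "movable T A f"
  have reach: "?n a \<le> ?n c + 1" if path: "?E\<^sup>*\<^sup>* a c" and ac: "a \<in> M" "c \<in> M" for a c
  proof (rule ccontr)
    assume neg: "\<not> ?thesis"
    obtain xs where "rtrancl_path ?E a xs c" "distinct (a # xs)"
      using path unfolding rtranclp_eq_rtrancl_path by (meson rtrancl_path_distinct)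
    from shift_along_path[OF this T, of f] f obtain g where "ok g"
      and g: "\<And>i. num_assigned T g i + of_bool (i = a) = ?n i + of_bool (i = c)"
      unfolding ok_def by blast
    have "?n c + 2 \<le> ?n a"
      using neg by simp
    with sum_squares_shift_less[OF M ac _ g] least[OF \<open>ok g\<close>] show False
      by simp
  qed
  have "?n a \<le> ?n b + 1" if a: "a \<in> M" and b: "b \<in> M" for a b
  proof (rule ccontr)
    assume neg: "\<not> ?thesis"
    define R where "R = {c \<in> M. ?E\<^sup>*\<^sup>* a c}"
    define Q where "Q = {c \<in> M. ?E\<^sup>*\<^sup>* c b}"
    have fin: "finite R" "finite Q" and mem: "a \<in> R" "b \<in> Q" and sub: "R \<subseteq> M" "Q \<subseteq> M"
      using M a b by (auto simp: R_def Q_def)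
    have pos: "0 < card R" "0 < card Q" "0 < card M"
      using fin mem M a card_gt_0_iff by blast+

    have "card R * (?n a - 1) = (\<Sum>i\<in>R. ?n a - 1)"
      by simp
    \<comment> \<open>Strictness comes from \<open>a\<close> itself: \<open>neg\<close> makes
      \<open>?n a\<close> positive, so the subtraction does not truncate.\<close>
    also have "\<dots> < (\<Sum>i\<in>R. ?n i)"
      using reach a neg fin mem by (intro sum_strict_mono_ex1) (force simp: R_def)+
    also have "\<dots> = card {t \<in> T. f t \<in> R}"
      using T fin by (simp add: sum_num_assigned)
    also have "\<dots> \<le> card {t \<in> T. A t \<subseteq> R}"
    proof (rule card_mono)
      show "{t \<in> T. f t \<in> R} \<subseteq> {t \<in> T. A t \<subseteq> R}"
      proof clarify
        fix t i assume t: "t \<in> T" "f t \<in> R" "i \<in> A t"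
        then have "?E (f t) i"
          by (auto simp: movable_def)
        with t A show "i \<in> R"
          unfolding R_def by (auto intro: rtranclp.rtrancl_into_rtrancl)
      qed
    qed (use T in simp)
    finally have "(?n a - 1) * card M * card R < card {t \<in> T. A t \<subseteq> R} * card M"
      using pos by (simp add: mult.assoc mult.commute mult.left_commute)
    also have "\<dots> \<le> card T * card R"
      by (rule hall[OF sub(1)])
    finally have upper: "(?n a - 1) * card M < card T"
      using pos by (simp only: mult_less_cancel2)

    \<comment> \<open>The upper bound on the tasks confined to \<open>M - Q\<close> turns into a
      lower bound on the tasks that could be done in \<open>Q\<close>.\<close>
    have "card T * card M = card T * (card Q + card (M - Q))"
      using fin sub M by (simp add: card_Diff_subset card_mono)
    moreover have "card T = card {t \<in> T. A t \<subseteq> M - Q} + card {t \<in> T. A t \<inter> Q \<noteq> {}}"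
    proof -
      have "T = {t \<in> T. A t \<subseteq> M - Q} \<union> {t \<in> T. A t \<inter> Q \<noteq> {}}"
        using A by blast
      then show ?thesis
        using T card_Un_disjoint[of "{t \<in> T. A t \<subseteq> M - Q}" "{t \<in> T. A t \<inter> Q \<noteq> {}}"] by auto
    qed
    moreover have "card {t \<in> T. A t \<subseteq> M - Q} * card M \<le> card T * card (M - Q)"
      by (rule hall) simp
    ultimately have "card T * card Q \<le> card {t \<in> T. A t \<inter> Q \<noteq> {}} * card M"
      by (simp add: add_mult_distrib add_mult_distrib2)
    also have "\<dots> \<le> card {t \<in> T. f t \<in> Q} * card M"
    proof (intro mult_right_mono card_mono)
      show "{t \<in> T. A t \<inter> Q \<noteq> {}} \<subseteq> {t \<in> T. f t \<in> Q}"
      proof (intro subsetI CollectI conjI)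
        fix t assume "t \<in> {t \<in> T. A t \<inter> Q \<noteq> {}}"
        then obtain i where t: "t \<in> T" "i \<in> A t" "i \<in> Q"
          by blast
        then show "t \<in> T"
          by simp
        have "?E (f t) i"
          using t
          by (auto simp: movable_def)
        moreover have "f t \<in> M"
          using t f A unfolding ok_def by blast
        ultimately show "f t \<in> Q"
          using t(3) unfolding Q_def by (auto intro: converse_rtranclp_into_rtranclp)
      qed
    qed (use T in simp_all)
    also have "card {t \<in> T. f t \<in> Q} = (\<Sum>i\<in>Q. ?n i)"
      using T fin by (simp add: sum_num_assigned)
    \<comment> \<open>Strict because \<open>b\<close> lies in \<open>Q\<close> and has load only
      \<open>?n b\<close>.\<close>
    also have "(\<Sum>i\<in>Q. ?n i) * card M < (\<Sum>i\<in>Q. ?n b + 1) * card M"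
    proof -
      have "(\<Sum>i\<in>Q. ?n i) < (\<Sum>i\<in>Q. ?n b + 1)"
        using reach b fin mem by (intro sum_strict_mono_ex1) (force simp: Q_def)+
      then show ?thesis
        using pos by simp
    qed
    also have "\<dots> = (?n b + 1) * card M * card Q"
      by (simp only: sum_constant of_nat_id mult.commute mult.left_commute)
    finally have lower: "card T < (?n b + 1) * card M"
      using pos by (simp only: mult_less_cancel2)
    \<comment> \<open>The overall average lies strictly above \<open>?n a - 1\<close> and strictly
      below \<open>?n b + 1\<close>, but \<open>neg\<close> puts these two bounds in the wrong
      order.\<close>
    have "(?n b + 1) * card M \<le> (?n a - 1) * card M"
      using neg by (intro mult_right_mono) auto
    with upper lower show False
      by simp
  qed
  with f show ?thesis
    unfolding ok_def by blast
qed

section \<open>The Hall condition for a design\<close>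

lemma double_count:
  assumes "finite S" "finite R"
  shows "(\<Sum>j\<in>S. card {i \<in> R. P i j}) = (\<Sum>i\<in>R. card {j \<in> S. P i j})"
  using sum.swap_restrict[OF assms, of "\<lambda>_ _. 1::nat" "\<lambda>j i. P i j"] by simp

lemma card_item_pairs: "finite X \<Longrightarrow> card (item_pairs X) = card X choose 2"
  unfolding item_pairs_def by (rule n_subsets)

lemma finite_item_pairs: "finite X \<Longrightarrow> finite (item_pairs X)"
  unfolding item_pairs_def by (rule finite_subset[of _ "Pow X"]) auto

text \<open>Count incidences: each symbol of \<open>?S\<close> has all its \<open>r\<close> blocks
  in \<open>R\<close>, and a block has \<open>k\<close> symbols, so \<open>card ?S * r\<close> is at
  most \<open>card R * k\<close>. Multiplying by \<open>v\<close> and using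
  \<open>v * r = card M * k\<close>, the factor \<open>k\<close> cancels.\<close>

lemma design_symbols_within_blocks:
  assumes d: "design_2_v_k_1 V M B v k" and k: "k > 0" and R: "R \<subseteq> M"
  shows "card {j \<in> V. {i \<in> M. j \<in> B i} \<subseteq> R} * card M \<le> v * card R"
proof -
  let ?S = "{j \<in> V. {i \<in> M. j \<in> B i} \<subseteq> R}"
  obtain r where V: "finite V" "card V = v" and M: "finite M"
    and B: "\<And>i. i \<in> M \<Longrightarrow> B i \<subseteq> V \<and> card (B i) = k"
    and r: "\<And>j. j \<in> V \<Longrightarrow> card {i \<in> M. j \<in> B i} = r"
    using d unfolding design_2_v_k_1_def by blast
  have finR: "finite R"
    using R M finite_subset by blast
  have "v * r = (\<Sum>j\<in>V. card {i \<in> M. j \<in> B i})"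
    using V r by simp
  also have "\<dots> = (\<Sum>i\<in>M. card {j \<in> V. j \<in> B i})"
    by (rule double_count[OF V(1) M])
  also have "\<dots> = (\<Sum>i\<in>M. k)"
    using B by (intro sum.cong refl) (metis Collect_mem_eq Int_def inf.absorb2)
  finally have vr: "v * r = card M * k"
    by simp
  have "card ?S * r = (\<Sum>j\<in>?S. card {i \<in> M. j \<in> B i})"
    using r by simp
  also have "\<dots> = (\<Sum>j\<in>?S. card {i \<in> R. j \<in> B i})"
    using R by (intro sum.cong refl arg_cong[of _ _ card]) blast
  also have "\<dots> = (\<Sum>i\<in>R. card {j \<in> ?S. j \<in> B i})"
    using V finR by (intro double_count) auto
  also have "\<dots> \<le> (\<Sum>i\<in>R. k)"
  proof (rule sum_mono)
    fix i assume "i \<in> R"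
    then have "i \<in> M"
      using R by blast
    then have "finite (B i)" "card (B i) = k"
      using B V finite_subset by blast+
    then show "card {j \<in> ?S. j \<in> B i} \<le> k"
      using card_mono[of "B i" "{j \<in> ?S. j \<in> B i}"] by auto
  qed
  finally have Sr: "card ?S * r \<le> card R * k"
    by simp
  have "card ?S * card M * k = card ?S * (v * r)"
    unfolding vr by (rule mult.assoc)
  also have "\<dots> = v * (card ?S * r)"
    by (rule mult.left_commute)
  also have "\<dots> \<le> v * (card R * k)"
    using Sr by simp
  finally show ?thesis
    using k by simp
qed

theorem theorem14:
  fixes V :: "'s set" and M :: "'m set" and B :: "'m \<Rightarrow> 's set"
    and D :: "'m \<Rightarrow> 's \<Rightarrow> nat" and s :: "'s \<Rightarrow> real"
    and X :: "'x set" and G :: "'s \<Rightarrow> 'x set"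
    and v k :: nat
  assumes "design_2_v_k_1 V M B v k"
    and "k \<ge> 2"
    and "(D, s) = derived_distribution V B"
    and "data_partition X V s G"
    and "\<forall>j\<in>V. \<forall>j'\<in>V. card (G j) = card (G j')"
  shows "\<exists>f. ATAC_schedule X V M D G f \<and> effectively_load_balanced X M f"
proof -
  obtain r where V: "finite V" "card V = v" and M: "finite M" "M \<noteq> {}"
    and B: "\<And>i. i \<in> M \<Longrightarrow> B i \<subseteq> V" "\<And>i. i \<in> M \<Longrightarrow> card (B i) = k"
    and r: "\<And>j. j \<in> V \<Longrightarrow> card {i \<in> M. j \<in> B i} = r"
    and pair: "\<And>j j'. j \<in> V \<Longrightarrow> j' \<in> V \<Longrightarrow> j \<noteq> j' \<Longrightarrow> card {i \<in> M. j \<in> B i \<and> j' \<in> B i} = 1"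
    using assms(1) unfolding design_2_v_k_1_def by blast
  have X: "finite X" "disjoint_family_on G V" "(\<Union>j\<in>V. G j) = X"
    using assms(4) by (auto simp: data_partition_def)
  have G_eq: "j = j'" if "x \<in> G j" "x \<in> G j'" "j \<in> V" "j' \<in> V" for x j j'
    using X(2) that by (auto simp: disjoint_family_on_def)
  have finG: "finite (G j)" if "j \<in> V" for j
    using X that by (auto intro: finite_subset)
  have finB: "finite (B i)" if "i \<in> M" for i
    using B V that by (auto intro: finite_subset)
  obtain n where n: "\<And>j. j \<in> V \<Longrightarrow> card (G j) = n"
    using assms(5) by metis
  have D: "D i j = 1 \<longleftrightarrow> j \<in> B i" for i j
    using assms(3) by (simp add: derived_distribution_def incidence_matrix_def)
  have holds: "holds_item V D G i x \<longleftrightarrow> (\<exists>j\<in>V. j \<in> B i \<and> x \<in> G j)" for i x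
    unfolding holds_item_def D ..

  \<comment> \<open>Pairs inside a group and pairs across groups\<close>
  let ?T = "item_pairs X"
  \<comment> \<open>\<open>A p\<close> collects the machines able to compare \<open>p\<close>. A
    pair in \<open>W j\<close> may go to any block containing \<open>j\<close>; a pair in
    \<open>C i\<close> crosses two groups of block \<open>i\<close> and will turn out to be forced
    onto \<open>i\<close>.\<close>
  define A where "A p = {i \<in> M. \<forall>x\<in>p. holds_item V D G i x}" for p
  define W where "W j = item_pairs (G j)" for j
  define C where "C i = item_pairs (\<Union>j\<in>B i. G j) - (\<Union>j\<in>B i. W j)" for i
  define w where "w = n choose 2"
  \<comment> \<open>All pairs among the \<open>k * n\<close> items of a block, minus those inside
    one of its \<open>k\<close> groups; the same number for every block.\<close>
  define c where "c = (k * n choose 2) - k * w"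

  have finW: "finite (W j)" and cardW: "card (W j) = w" if "j \<in> V" for j
    using that finG n by (auto simp: W_def w_def card_item_pairs finite_item_pairs)
  have W_eq: "j = j'" if p: "p \<in> W j" "p \<in> W j'" and j: "j \<in> V" "j' \<in> V" for p j j'
  proof -
    obtain x where "x \<in> p" "x \<in> G j" "x \<in> G j'"
      using p by (auto simp: W_def item_pairs_def card_2_iff)
    then show ?thesis
      using G_eq j by blast
  qed
  have cardC: "finite (C i)" "card (C i) = c" if i: "i \<in> M" for i
  proof -
    have finU: "finite (\<Union>j\<in>B i. G j)"
      using finB[OF i] finG B(1)[OF i] by blast
    have "card (\<Union>j\<in>B i. G j) = (\<Sum>j\<in>B i. card (G j))"
      using finB[OF i] finG B(1)[OF i] G_eq by (intro card_UN_disjoint) blast+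
    also have "\<dots> = k * n"
      using n B i by (subst sum.cong[OF refl, of _ _ "\<lambda>_. n"]) auto
    finally have U: "card (\<Union>j\<in>B i. G j) = k * n" .
    have "card (\<Union>j\<in>B i. W j) = (\<Sum>j\<in>B i. card (W j))"
      using finB[OF i] finW B(1)[OF i] W_eq by (intro card_UN_disjoint) blast+
    also have "\<dots> = k * w"
      using cardW B i by (subst sum.cong[OF refl, of _ _ "\<lambda>_. w"]) auto
    finally have "card (\<Union>j\<in>B i. W j) = k * w" .
    moreover have "finite (\<Union>j\<in>B i. W j)"
      using finB[OF i] finW B(1)[OF i] by blast
    moreover have "(\<Union>j\<in>B i. W j) \<subseteq> item_pairs (\<Union>j\<in>B i. G j)"
      by (auto simp: W_def item_pairs_def)
    ultimately show "card (C i) = c"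
      unfolding C_def c_def using finU U by (simp add: card_Diff_subset card_item_pairs)
    show "finite (C i)"
      unfolding C_def using finU finite_item_pairs by blast
  qed

  \<comment> \<open>Here the value 1 of lambda enters: the two items belong to distinct symbols,
    which share exactly one block.\<close>
  have cross: "card (A p) = 1" if p: "p \<in> ?T" and notW: "\<forall>j\<in>V. p \<notin> W j" for p
  proof -
    obtain x y where xy: "p = {x, y}" "x \<noteq> y" "x \<in> X" "y \<in> X"
      using p by (auto simp: item_pairs_def card_2_iff)
    then obtain j j' where j: "j \<in> V" "j' \<in> V" "x \<in> G j" "y \<in> G j'"
      using X(3) by blast
    have "j \<noteq> j'"
      using notW xy j by (auto simp: W_def item_pairs_def)
    moreover have "A p = {i' \<in> M. j \<in> B i' \<and> j' \<in> B i'}"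
      using xy j G_eq unfolding A_def holds by blast
    ultimately show ?thesis
      using j pair by simp
  qed
  \<comment> \<open>\<open>C\<close> was defined so that it can be counted; in terms of
    \<open>A\<close> the sets \<open>C i\<close> are visibly disjoint, and a crossing pair is
    located by its only machine.\<close>
  have C_iff: "p \<in> C i \<longleftrightarrow> p \<in> ?T \<and> (\<forall>j\<in>V. p \<notin> W j) \<and> A p = {i}" if i: "i \<in> M" for p i
  proof
    assume p: "p \<in> C i"
    have "(\<Union>j\<in>B i. G j) \<subseteq> X"
      using B(1)[OF i] X(3) by blast
    then have T: "p \<in> ?T"
      using p by (auto simp: C_def item_pairs_def)
    have notW: "p \<notin> W j" if "j \<in> V" for j
    proof
      assume W: "p \<in> W j"
      then obtain x where "x \<in> p" "x \<in> G j"
        by (auto simp: W_def item_pairs_def card_2_iff)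
      moreover from p \<open>x \<in> p\<close> obtain j' where "j' \<in> B i" "x \<in> G j'"
        by (auto simp: C_def item_pairs_def)
      ultimately have "j \<in> B i"
        using G_eq \<open>j \<in> V\<close> B(1)[OF i] by blast
      then show False
        using p W by (auto simp: C_def)
    qed
    have "i \<in> A p"
      using p i B(1)[OF i] by (fastforce simp: A_def holds C_def item_pairs_def)
    moreover have "card (A p) = 1"
      using cross[OF T] notW by blast
    ultimately have "A p = {i}"
      by (metis card_1_singletonE singletonD)
    with T notW show "p \<in> ?T \<and> (\<forall>j\<in>V. p \<notin> W j) \<and> A p = {i}"
      by blast
  next
    assume p: "p \<in> ?T \<and> (\<forall>j\<in>V. p \<notin> W j) \<and> A p = {i}"
    then have "\<forall>x\<in>p. \<exists>j\<in>V. j \<in> B i \<and> x \<in> G j"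
      unfolding A_def holds by blast
    with p B(1)[OF i] show "p \<in> C i"
      by (auto simp: C_def item_pairs_def)
  qed
  have A_W: "A p = {i \<in> M. j \<in> B i}" if "p \<in> W j" "j \<in> V" for p j
  proof -
    have "p \<subseteq> G j" "p \<noteq> {}"
      using that(1) by (auto simp: W_def item_pairs_def)
    then show ?thesis
      using G_eq that(2) unfolding A_def holds by blast
  qed
  have W_sub: "W j \<subseteq> ?T" if "j \<in> V" for j
    using X(3) that by (auto simp: W_def item_pairs_def)

  \<comment> \<open>Ensures that a pair inside a group has some admissible machine.\<close>
  have r_pos: "r > 0"
  proof -
    obtain i where i: "i \<in> M"
      using M by blast
    then obtain j where "j \<in> B i"
      using B(2)[OF i] assms(2) by fastforce
    then have "0 < card {i \<in> M. j \<in> B i}" "j \<in> V"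
      using i B(1) M(1) by (auto simp: card_gt_0_iff)
    then show ?thesis
      using r by simp
  qed

  \<comment> \<open>The Hall condition for the pairs\<close>
  have total: "c * card M + w * v \<le> card ?T"
  proof -
    have "C i \<inter> C i' = {}" if "i \<in> M" "i' \<in> M" "i \<noteq> i'" for i i'
      using that C_iff by (metis disjoint_iff singleton_inject)
    then have "card (\<Union>i\<in>M. C i) = (\<Sum>i\<in>M. card (C i))"
      using M(1) cardC(1) by (intro card_UN_disjoint) auto
    moreover have "card (\<Union>j\<in>V. W j) = (\<Sum>j\<in>V. card (W j))"
      using V(1) finW W_eq by (intro card_UN_disjoint) blast+
    moreover have "card ((\<Union>i\<in>M. C i) \<union> (\<Union>j\<in>V. W j)) = card (\<Union>i\<in>M. C i) + card (\<Union>j\<in>V. W j)"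
    proof (rule card_Un_disjoint)
      show "(\<Union>i\<in>M. C i) \<inter> (\<Union>j\<in>V. W j) = {}"
        using C_iff by blast
    qed (use M(1) V(1) cardC(1) finW in auto)
    \<comment> \<open>A lower bound on \<open>card ?T\<close> suffices, since it occurs only on the
      larger side of the Hall condition.\<close>
    moreover have "(\<Union>i\<in>M. C i) \<union> (\<Union>j\<in>V. W j) \<subseteq> ?T"
      using W_sub C_iff by blast
    then have "card ((\<Union>i\<in>M. C i) \<union> (\<Union>j\<in>V. W j)) \<le> card ?T"
      by (intro card_mono finite_item_pairs X(1))
    ultimately show ?thesis
      using cardC cardW V by (simp add: mult.commute)
  qed

  have hall: "card {p \<in> ?T. A p \<subseteq> R} * card M \<le> card ?T * card R" if R: "R \<subseteq> M" for R
  proof -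
    let ?S = "{j \<in> V. {i \<in> M. j \<in> B i} \<subseteq> R}"
    have finR: "finite R"
      using R M finite_subset by blast
    \<comment> \<open>A pair confined to \<open>R\<close> either crosses groups and is forced onto
      one block of \<open>R\<close>, or lies inside a group whose blocks all belong to
      \<open>R\<close>.\<close>
    have "{p \<in> ?T. A p \<subseteq> R} \<subseteq> (\<Union>i\<in>R. C i) \<union> (\<Union>j\<in>?S. W j)"
    proof clarify
      fix p assume p: "p \<in> ?T" "A p \<subseteq> R" "p \<notin> (\<Union>j\<in>?S. W j)"
      have notW: "\<forall>j\<in>V. p \<notin> W j"
      proof (intro ballI notI)
        fix j assume "j \<in> V" "p \<in> W j"
        then have "j \<in> ?S"
          using A_W p(2) by auto
        then show False
          using \<open>p \<in> W j\<close> p(3) by blast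
      qed
      obtain i where "A p = {i}"
        using cross[OF p(1) notW] by (meson card_1_singletonE)
      moreover from this have "i \<in> R"
        using p(2) by blast
      ultimately show "p \<in> (\<Union>i\<in>R. C i)"
        using C_iff R p(1) notW by blast
    qed
    moreover have "finite ((\<Union>i\<in>R. C i) \<union> (\<Union>j\<in>?S. W j))"
      using finR R V cardC finW by auto
    ultimately have "card {p \<in> ?T. A p \<subseteq> R} \<le> card ((\<Union>i\<in>R. C i) \<union> (\<Union>j\<in>?S. W j))"
      by (rule card_mono[rotated])
    also have "\<dots> \<le> card (\<Union>i\<in>R. C i) + card (\<Union>j\<in>?S. W j)"
      by (rule card_Un_le)
    also have "\<dots> \<le> (\<Sum>i\<in>R. card (C i)) + (\<Sum>j\<in>?S. card (W j))"
      using finR V by (intro add_mono card_UN_le) auto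
    also have "(\<Sum>i\<in>R. card (C i)) = (\<Sum>i\<in>R. c)"
      using cardC R by (intro sum.cong) auto
    also have "(\<Sum>j\<in>?S. card (W j)) = (\<Sum>j\<in>?S. w)"
      using cardW by (intro sum.cong) auto
    finally have "card {p \<in> ?T. A p \<subseteq> R} * card M \<le> (card R * c + card ?S * w) * card M"
      by simp
    also have "\<dots> = c * card M * card R + w * (card ?S * card M)"
      by (simp add: algebra_simps)
    \<comment> \<open>The crossing pairs are already proportional to \<open>card R\<close>; only the
      pairs inside groups need the incidence count.\<close>
    also have "\<dots> \<le> c * card M * card R + w * (v * card R)"
      using design_symbols_within_blocks[OF assms(1) _ R] assms(2) by simp
    also have "\<dots> = (c * card M + w * v) * card R"
      by (simp add: algebra_simps)
    also have "\<dots> \<le> card ?T * card R"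
      using total by simp
    finally show ?thesis .
  qed

  have admissible: "A p \<subseteq> M \<and> A p \<noteq> {}" if p: "p \<in> ?T" for p
  proof (cases "\<exists>j\<in>V. p \<in> W j")
    case True
    then obtain j where "j \<in> V" "A p = {i \<in> M. j \<in> B i}"
      using A_W by blast
    moreover from this have "card (A p) > 0"
      using r r_pos by simp
    ultimately show ?thesis
      by (auto simp: card_gt_0_iff)
  next
    case False
    then have "card (A p) = 1"
      using cross[OF p] by blast
    then have "A p \<noteq> {}"
      by force
    then show ?thesis
      unfolding A_def by blast
  qed

  obtain f where "\<forall>p\<in>?T. f p \<in> A p"
    and "\<forall>i\<in>M. \<forall>i'\<in>M. num_assigned ?T f i \<le> num_assigned ?T f i' + 1"
    using balanced_assignment[OF finite_item_pairs[OF X(1)] M(1) admissible hall] by blast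
  then show ?thesis
    unfolding ATAC_schedule_def effectively_load_balanced_def load_def num_assigned_def A_def
    by (intro exI[of _ f]) auto
qed

end
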